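(* Let $G$ be a finite group, $A$ a subgroup of $\operatorname{Aut}(G)$ and $t$ a positive integer. Let $\phi^*(G,t)$ be the number of $t$-tuples $(H_1,\dots,H_t)$ of subgroups of $G$ such that $G=\langle H_1,\dots,H_t\rangle$, and for $H\leq G$ let $\sigma_A(H,t)$ be the number of $t$-tuples $(H_1,\dots,H_t)$ of subgroups of $G$ such that $\langle H_1,\dots,H_t\rangle\leq H^a$ for some $a\in A$. Then $$\phi^*(G,t)=\sum_{[H]_A\in \mathcal C_A(G)}\mu_A(H,G)\,\sigma_A(H,t).$$
   Context: The Möbius function of a finite poset $P$ is the map $\mu_P:P\times P\to\mathbb Z$ with $\mu_P(x,y)=0$ unless $x\leq y$, $\mu_P(x,x)=1$, and $\sum_{x\leq z\leq y}\mu_P(x,z)=0$ for $x<y$. For a finite group $G$ and $A\leq \operatorname{Aut}(G)$, let $[H]_A=\{H^a\mid a\in A\}$ for $H\leq G$, and let $\mathcal C_A(G)$ be the set of all $[H]_A$, $H\le G$, partially ordered by: $[H]_A\leq [K]_A$ if $H^a\leq K$ for some $a\in A$. Let $\mu_A$ be the Möbius function of the poset $\mathcal C_A(G)$ and write $\mu_A(H,K)=\mu_A([H]_A,[K]_A)$. *)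

theory Defs
  imports "HOL-Algebra.Bij" "HOL-Algebra.Generated_Groups"
begin

section \<open>The Moebius function of a finite poset\<close>

text \<open>The defining conditions constrain the function on the carrier only; the last clause makes it
  a unique total HOL function.\<close>

definition is_moebius :: "('a, 'c) gorder_scheme \<Rightarrow> ('a \<Rightarrow> 'a \<Rightarrow> int) \<Rightarrow> bool" where
  "is_moebius P f \<longleftrightarrow>
     (\<forall>x\<in>carrier P. \<forall>y\<in>carrier P. \<not> x \<sqsubseteq>\<^bsub>P\<^esub> y \<longrightarrow> f x y = 0) \<and>
     (\<forall>x\<in>carrier P. f x x = 1) \<and>
     (\<forall>x\<in>carrier P. \<forall>y\<in>carrier P. x \<sqsubset>\<^bsub>P\<^esub> y \<longrightarrow>
        (\<Sum>z\<in>{z \<in> carrier P. x \<sqsubseteq>\<^bsub>P\<^esub> z \<and> z \<sqsubseteq>\<^bsub>P\<^esub> y}. f x z) = 0) \<and>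
     (\<forall>x y. x \<notin> carrier P \<or> y \<notin> carrier P \<longrightarrow> f x y = 0)"

definition moebius :: "('a, 'c) gorder_scheme \<Rightarrow> 'a \<Rightarrow> 'a \<Rightarrow> int" where
  "moebius P = (THE f. is_moebius P f)"

lemma finite_poset_wf:
  assumes "partial_order P" "finite (carrier P)"
  shows "wf {(z, y). z \<in> carrier P \<and> y \<in> carrier P \<and> z \<sqsubset>\<^bsub>P\<^esub> y}"
proof -
  interpret partial_order P by fact
  let ?d = "\<lambda>y. {w \<in> carrier P. w \<sqsubseteq>\<^bsub>P\<^esub> y}"
  have "card (?d z) < card (?d y)" if "z \<in> carrier P" "y \<in> carrier P" "z \<sqsubset>\<^bsub>P\<^esub> y" for z y
  proof (rule psubset_card_mono)
    show "finite (?d y)" using assms(2) by simp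
    have zy: "z \<sqsubseteq>\<^bsub>P\<^esub> y" "z \<noteq> y" using that by (auto simp: lless_eq)
    have "?d z \<subseteq> ?d y" using zy that by (auto intro: le_trans)
    moreover have "y \<in> ?d y" using that by simp
    moreover have "y \<notin> ?d z" using zy that by (auto dest: le_antisym)
    ultimately show "?d z \<subset> ?d y" by blast
  qed
  then have "{(z, y). z \<in> carrier P \<and> y \<in> carrier P \<and> z \<sqsubset>\<^bsub>P\<^esub> y} \<subseteq> measure (\<lambda>y. card (?d y))"
    by auto
  then show ?thesis by (rule wf_subset[OF wf_measure])
qed

lemma interval_sum_split:
  fixes f :: "'a \<Rightarrow> int"
  assumes "partial_order P" "finite (carrier P)" "x \<in> carrier P" "y \<in> carrier P" "x \<sqsubset>\<^bsub>P\<^esub> y"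
  shows "(\<Sum>z\<in>{z \<in> carrier P. x \<sqsubseteq>\<^bsub>P\<^esub> z \<and> z \<sqsubseteq>\<^bsub>P\<^esub> y}. f z)
       = f y + (\<Sum>z\<in>{z \<in> carrier P. x \<sqsubseteq>\<^bsub>P\<^esub> z \<and> z \<sqsubset>\<^bsub>P\<^esub> y}. f z)"
proof -
  interpret partial_order P by fact
  have "{z \<in> carrier P. x \<sqsubseteq>\<^bsub>P\<^esub> z \<and> z \<sqsubseteq>\<^bsub>P\<^esub> y}
      = insert y {z \<in> carrier P. x \<sqsubseteq>\<^bsub>P\<^esub> z \<and> z \<sqsubset>\<^bsub>P\<^esub> y}"
    using assms by (auto simp: lless_eq)
  then show ?thesis
    using assms(2) by (simp add: lless_eq)
qed

theorem ex1_is_moebius: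
  assumes "partial_order P" "finite (carrier P)"
  shows "\<exists>!f. is_moebius P f"
proof -
  interpret partial_order P by fact
  define R where "R = {(z, y). z \<in> carrier P \<and> y \<in> carrier P \<and> z \<sqsubset>\<^bsub>P\<^esub> y}"
  have wf: "wf R" unfolding R_def by (rule finite_poset_wf[OF assms])
  define F where "F = (\<lambda>x (g :: 'a \<Rightarrow> int) y.
    if x = y then 1 else if x \<sqsubseteq>\<^bsub>P\<^esub> y
    then - (\<Sum>z\<in>{z \<in> carrier P. x \<sqsubseteq>\<^bsub>P\<^esub> z \<and> z \<sqsubset>\<^bsub>P\<^esub> y}. g z) else 0)"
  define h where "h = (\<lambda>x. wfrec R (F x))"
  have h: "h x y = F x (h x) y" if "y \<in> carrier P" for x y
  proof -
    have "h x y = F x (cut (h x) R y) y"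
      unfolding h_def by (rule wfrec[OF wf])
    also have "\<dots> = F x (h x) y"
      using that unfolding F_def by (auto intro!: sum.cong simp: cut_def R_def)
    finally show ?thesis .
  qed
  define f where "f = (\<lambda>x y. if x \<in> carrier P \<and> y \<in> carrier P then h x y else 0)"
  have "is_moebius P f"
    unfolding is_moebius_def
  proof (intro conjI ballI allI impI)
    fix x y assume x: "x \<in> carrier P" and y: "y \<in> carrier P" and xy: "x \<sqsubset>\<^bsub>P\<^esub> y"
    have le: "x \<sqsubseteq>\<^bsub>P\<^esub> y" "x \<noteq> y" using xy x by (auto simp: lless_eq)
    have "f x y = - (\<Sum>z\<in>{z \<in> carrier P. x \<sqsubseteq>\<^bsub>P\<^esub> z \<and> z \<sqsubset>\<^bsub>P\<^esub> y}. h x z)"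
      using h[OF y, of x] le x y by (simp add: f_def F_def)
    also have "\<dots> = - (\<Sum>z\<in>{z \<in> carrier P. x \<sqsubseteq>\<^bsub>P\<^esub> z \<and> z \<sqsubset>\<^bsub>P\<^esub> y}. f x z)"
      using x by (auto simp: f_def intro!: sum.cong)
    finally show "(\<Sum>z\<in>{z \<in> carrier P. x \<sqsubseteq>\<^bsub>P\<^esub> z \<and> z \<sqsubseteq>\<^bsub>P\<^esub> y}. f x z) = 0"
      using interval_sum_split[OF assms x y xy, of "f x"] by simp
  next
    fix x y assume "x \<in> carrier P" "y \<in> carrier P" "\<not> x \<sqsubseteq>\<^bsub>P\<^esub> y"
    then show "f x y = 0" using h[of y x] by (auto simp: f_def F_def)
  next
    fix x assume "x \<in> carrier P"
    then show "f x x = 1" using h[of x x] by (simp add: f_def F_def)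
  qed (auto simp: f_def)
  moreover have "f1 = f2" if m: "is_moebius P f1" "is_moebius P f2" for f1 f2
  proof (intro ext)
    fix x y
    show "f1 x y = f2 x y"
    proof (induction y rule: wf_induct_rule[OF wf])
      case (1 y)
      show ?case
      proof (cases "x \<in> carrier P \<and> y \<in> carrier P \<and> x \<sqsubset>\<^bsub>P\<^esub> y")
        case True
        then have x: "x \<in> carrier P" and y: "y \<in> carrier P" and xy: "x \<sqsubset>\<^bsub>P\<^esub> y" by auto
        have "(\<Sum>z\<in>{z \<in> carrier P. x \<sqsubseteq>\<^bsub>P\<^esub> z \<and> z \<sqsubset>\<^bsub>P\<^esub> y}. f1 x z)
            = (\<Sum>z\<in>{z \<in> carrier P. x \<sqsubseteq>\<^bsub>P\<^esub> z \<and> z \<sqsubset>\<^bsub>P\<^esub> y}. f2 x z)"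
          using 1 y by (auto intro!: sum.cong simp: R_def)
        moreover have "(\<Sum>z\<in>{z \<in> carrier P. x \<sqsubseteq>\<^bsub>P\<^esub> z \<and> z \<sqsubseteq>\<^bsub>P\<^esub> y}. f1 x z) = 0"
          "(\<Sum>z\<in>{z \<in> carrier P. x \<sqsubseteq>\<^bsub>P\<^esub> z \<and> z \<sqsubseteq>\<^bsub>P\<^esub> y}. f2 x z) = 0"
          using m x y xy unfolding is_moebius_def by blast+
        ultimately show ?thesis
          using interval_sum_split[OF assms x y xy, of "f1 x"]
            interval_sum_split[OF assms x y xy, of "f2 x"] by simp
      next
        case False
        then consider "x \<notin> carrier P \<or> y \<notin> carrier P"
          | "x \<in> carrier P" "y \<in> carrier P" "x = y"
          | "x \<in> carrier P" "y \<in> carrier P" "\<not> x \<sqsubseteq>\<^bsub>P\<^esub> y"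
          by (auto simp: lless_eq)
        then show ?thesis
        proof cases
          case 1
          then have "f1 x y = 0" "f2 x y = 0" using m unfolding is_moebius_def by blast+
          then show ?thesis by simp
        next
          case 2
          then have "f1 x y = 1" "f2 x y = 1" using m unfolding is_moebius_def by blast+
          then show ?thesis by simp
        next
          case 3
          then have "f1 x y = 0" "f2 x y = 0" using m unfolding is_moebius_def by blast+
          then show ?thesis by simp
        qed
      qed
    qed
  qed
  ultimately show ?thesis by blast
qed

corollary is_moebius_moebius:
  assumes "partial_order P" "finite (carrier P)"
  shows "is_moebius P (moebius P)"
  unfolding moebius_def by (rule theI'[OF ex1_is_moebius[OF assms]])


section \<open>Classes of subgroups under automorphisms\<close>

text \<open>The exponent notation \<open>H\<^sup>a\<close> is rendered as the image \<open>a ` H\<close>.\<close>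

definition aut_class :: "('a \<Rightarrow> 'a) set \<Rightarrow> 'a set \<Rightarrow> 'a set set" where
  "aut_class A H = {a ` H | a. a \<in> A}"

definition class_poset ::
  "('a, 'b) monoid_scheme \<Rightarrow> ('a \<Rightarrow> 'a) set \<Rightarrow> 'a set set gorder" where
  "class_poset G A =
     \<lparr>carrier = {aut_class A H | H. subgroup H G},
      eq = (=),
      le = (\<lambda>X Y. \<exists>H K. subgroup H G \<and> subgroup K G \<and> X = aut_class A H \<and> Y = aut_class A K
                    \<and> (\<exists>a\<in>A. a ` H \<subseteq> K))\<rparr>"

definition mu_A ::
  "('a, 'b) monoid_scheme \<Rightarrow> ('a \<Rightarrow> 'a) set \<Rightarrow> 'a set \<Rightarrow> 'a set \<Rightarrow> int" where
  "mu_A G A H K = moebius (class_poset G A) (aut_class A H) (aut_class A K)"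

definition subgroup_tuples :: "('a, 'b) monoid_scheme \<Rightarrow> nat \<Rightarrow> (nat \<Rightarrow> 'a set) set" where
  "subgroup_tuples G t = {1..t} \<rightarrow>\<^sub>E {H. subgroup H G}"

definition phi_star :: "('a, 'b) monoid_scheme \<Rightarrow> nat \<Rightarrow> nat" where
  "phi_star G t =
     card {Hs \<in> subgroup_tuples G t. carrier G = generate G (\<Union>i\<in>{1..t}. Hs i)}"

definition sigma_A ::
  "('a, 'b) monoid_scheme \<Rightarrow> ('a \<Rightarrow> 'a) set \<Rightarrow> 'a set \<Rightarrow> nat \<Rightarrow> nat" where
  "sigma_A G A H t =
     card {Hs \<in> subgroup_tuples G t. \<exists>a\<in>A. generate G (\<Union>i\<in>{1..t}. Hs i) \<subseteq> a ` H}"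

context
  fixes G :: "('a, 'b) monoid_scheme" and A :: "('a \<Rightarrow> 'a) set"
  assumes grp: "group G" and fin: "finite (carrier G)" and sub: "subgroup A (AutoGroup G)"
begin

lemma aut_closed:
  shows "a \<in> A \<Longrightarrow> a \<in> auto G"
    and "(\<lambda>x\<in>carrier G. x) \<in> A"
    and "a \<in> A \<Longrightarrow> b \<in> A \<Longrightarrow> compose (carrier G) a b \<in> A"
    and "a \<in> A \<Longrightarrow> (\<lambda>x\<in>carrier G. inv_into (carrier G) a x) \<in> A"
proof -
  interpret group G by (rule grp)
  interpret AG: group "AutoGroup G" by (rule AutoGroup)
  show au: "\<And>a. a \<in> A \<Longrightarrow> a \<in> auto G"
    using subgroup.subset[OF sub] by (auto simp: AutoGroup_def)
  show "(\<lambda>x\<in>carrier G. x) \<in> A"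
    using subgroup.one_closed[OF sub] by (simp add: AutoGroup_def BijGroup_def)
  show "compose (carrier G) a b \<in> A" if "a \<in> A" "b \<in> A"
    using subgroup.m_closed[OF sub that] au[OF that(1)] au[OF that(2)]
    by (simp add: AutoGroup_def BijGroup_def auto_def)
  show "(\<lambda>x\<in>carrier G. inv_into (carrier G) a x) \<in> A" if "a \<in> A"
  proof -
    have B: "a \<in> Bij (carrier G)" using au[OF that] by (simp add: auto_def)
    have "inv\<^bsub>AutoGroup G\<^esub> a = inv\<^bsub>BijGroup (carrier G)\<^esub> a"
      unfolding AutoGroup_def
      using group.m_inv_consistent[OF group_BijGroup subgroup_auto] au[OF that] by simp
    then show ?thesis
      using subgroup.m_inv_closed[OF sub that] inv_BijGroup[OF B] by simp
  qed
qed

lemma aut_class_trans: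
  assumes "H \<subseteq> carrier G" "a \<in> A"
  shows "aut_class A (a ` H) = aut_class A H"
proof
  have B: "bij_betw a (carrier G) (carrier G)"
    using aut_closed(1)[OF assms(2)] by (simp add: auto_def Bij_def)
  show "aut_class A (a ` H) \<subseteq> aut_class A H"
  proof
    fix X assume "X \<in> aut_class A (a ` H)"
    then obtain b where b: "b \<in> A" "X = b ` a ` H" by (auto simp: aut_class_def)
    have "X = compose (carrier G) b a ` H"
      using assms(1) b(2) by (force simp: compose_def)
    then show "X \<in> aut_class A H"
      using aut_closed(3)[OF b(1) assms(2)] by (auto simp: aut_class_def)
  qed
  show "aut_class A H \<subseteq> aut_class A (a ` H)"
  proof
    fix X assume "X \<in> aut_class A H"
    then obtain b where b: "b \<in> A" "X = b ` H" by (auto simp: aut_class_def)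
    let ?c = "compose (carrier G) b (\<lambda>x\<in>carrier G. inv_into (carrier G) a x)"
    have "?c (a h) = b h" if "h \<in> H" for h
    proof -
      have "h \<in> carrier G" "a h \<in> carrier G"
        using that assms(1) B by (auto simp: bij_betw_def)
      then show ?thesis
        using B by (simp add: compose_def bij_betw_def inv_into_f_f)
    qed
    then have "X = ?c ` a ` H"
      using b(2) by (simp add: image_image cong: image_cong)
    then show "X \<in> aut_class A (a ` H)"
      using aut_closed(3)[OF b(1) aut_closed(4)[OF assms(2)]] by (auto simp: aut_class_def)
  qed
qed

lemma self_in_aut_class:
  assumes "H \<subseteq> carrier G"
  shows "H \<in> aut_class A H"
proof -
  have "H = (\<lambda>x\<in>carrier G. x) ` H" using assms by force
  then show ?thesis using aut_closed(2) unfolding aut_class_def by blast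
qed

lemma class_poset_le_iff:
  assumes H: "subgroup H G" and K: "subgroup K G"
  shows "aut_class A H \<sqsubseteq>\<^bsub>class_poset G A\<^esub> aut_class A K \<longleftrightarrow> (\<exists>a\<in>A. a ` H \<subseteq> K)"
proof
  assume "aut_class A H \<sqsubseteq>\<^bsub>class_poset G A\<^esub> aut_class A K"
  then obtain H' K' a where H': "subgroup H' G" and K': "subgroup K' G"
    and eq: "aut_class A H = aut_class A H'" "aut_class A K = aut_class A K'"
    and a: "a \<in> A" "a ` H' \<subseteq> K'"
    unfolding class_poset_def gorder.simps by blast
  have "H' \<in> aut_class A H" "K' \<in> aut_class A K"
    unfolding eq using self_in_aut_class subgroup.subset[OF H'] subgroup.subset[OF K'] by blast+
  then obtain b where b: "b \<in> A" "H' = b ` H"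
    by (auto simp: aut_class_def)
  have "K \<in> aut_class A K'"
    unfolding eq(2)[symmetric] by (rule self_in_aut_class[OF subgroup.subset[OF K]])
  then obtain d where d: "d \<in> A" "K = d ` K'"
    by (auto simp: aut_class_def)
  let ?e = "compose (carrier G) d (compose (carrier G) a b)"
  have "?e h \<in> K" if "h \<in> H" for h
  proof -
    have "h \<in> carrier G" using that subgroup.subset[OF H] by blast
    then have "?e h = d (a (b h))" by (simp add: compose_def)
    moreover have "a (b h) \<in> K'" using that a(2) b(2) by blast
    ultimately show ?thesis using d(2) by simp
  qed
  then have "?e ` H \<subseteq> K" by blast
  moreover have "?e \<in> A"
    by (intro aut_closed(3) a(1) b(1) d(1))
  ultimately show "\<exists>a\<in>A. a ` H \<subseteq> K" by (rule bexI)
next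
  assume "\<exists>a\<in>A. a ` H \<subseteq> K"
  then show "aut_class A H \<sqsubseteq>\<^bsub>class_poset G A\<^esub> aut_class A K"
    unfolding class_poset_def gorder.simps using assms by blast
qed

lemma finite_class_poset: "finite (carrier (class_poset G A))"
proof -
  have "finite {H. subgroup H G}"
    by (rule finite_subset[of _ "Pow (carrier G)"]) (auto simp: fin dest: subgroup.subset)
  moreover have "carrier (class_poset G A) = aut_class A ` {H. subgroup H G}"
    by (auto simp: class_poset_def)
  ultimately show ?thesis by simp
qed

theorem partial_order_class_poset: "partial_order (class_poset G A)"
proof -
  have car: "\<exists>H. subgroup H G \<and> X = aut_class A H" if "X \<in> carrier (class_poset G A)" for X
    using that by (auto simp: class_poset_def)
  have eq: "(.=\<^bsub>class_poset G A\<^esub>) = (=)" by (simp add: class_poset_def)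
  have refl: "X \<sqsubseteq>\<^bsub>class_poset G A\<^esub> X" if "X \<in> carrier (class_poset G A)" for X
  proof -
    from car[OF that] obtain H where H: "subgroup H G" "X = aut_class A H" by blast
    have "(\<lambda>x\<in>carrier G. x) ` H \<subseteq> H" using subgroup.subset[OF H(1)] by auto
    then have "\<exists>c\<in>A. c ` H \<subseteq> H" using aut_closed(2) by (rule bexI)
    then show ?thesis using class_poset_le_iff[OF H(1) H(1)] H(2) by simp
  qed
  have antisym: "X = Y"
    if le: "X \<sqsubseteq>\<^bsub>class_poset G A\<^esub> Y" "Y \<sqsubseteq>\<^bsub>class_poset G A\<^esub> X"
      and mem: "X \<in> carrier (class_poset G A)" "Y \<in> carrier (class_poset G A)" for X Y
  proof -
    obtain H K where H: "subgroup H G" "X = aut_class A H" and K: "subgroup K G" "Y = aut_class A K"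
      using car[OF mem(1)] car[OF mem(2)] by blast
    obtain a b where a: "a \<in> A" "a ` H \<subseteq> K" and b: "b \<in> A" "b ` K \<subseteq> H"
      using le class_poset_le_iff[OF H(1) K(1)] class_poset_le_iff[OF K(1) H(1)] H(2) K(2) by blast
    have sub': "H \<subseteq> carrier G" "K \<subseteq> carrier G" using H K subgroup.subset by blast+
    then have f: "finite H" "finite K" using fin finite_subset by blast+
    have inj: "inj_on a H" "inj_on b K"
      using aut_closed(1)[OF a(1)] aut_closed(1)[OF b(1)] sub'
      by (auto simp: auto_def Bij_def bij_betw_def intro: inj_on_subset)
    have "card K \<le> card H" using card_mono[OF f(1) b(2)] card_image[OF inj(2)] by simp
    then have "a ` H = K"
      using card_seteq[OF f(2) a(2)] card_image[OF inj(1)] by simp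
    then show ?thesis using aut_class_trans[OF sub'(1) a(1)] H(2) K(2) by simp
  qed
  have trans: "X \<sqsubseteq>\<^bsub>class_poset G A\<^esub> Z"
    if le: "X \<sqsubseteq>\<^bsub>class_poset G A\<^esub> Y" "Y \<sqsubseteq>\<^bsub>class_poset G A\<^esub> Z"
      and mem: "X \<in> carrier (class_poset G A)" "Y \<in> carrier (class_poset G A)"
      "Z \<in> carrier (class_poset G A)" for X Y Z
  proof -
    obtain H K L where H: "subgroup H G" "X = aut_class A H" and K: "subgroup K G" "Y = aut_class A K"
      and L: "subgroup L G" "Z = aut_class A L"
      using car[OF mem(1)] car[OF mem(2)] car[OF mem(3)] by blast
    obtain a b where a: "a \<in> A" "a ` H \<subseteq> K" and b: "b \<in> A" "b ` K \<subseteq> L"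
      using le class_poset_le_iff[OF H(1) K(1)] class_poset_le_iff[OF K(1) L(1)] H(2) K(2) L(2) by blast
    have "compose (carrier G) b a h \<in> L" if "h \<in> H" for h
    proof -
      have "h \<in> carrier G" using that subgroup.subset[OF H(1)] by blast
      then have "compose (carrier G) b a h = b (a h)" by (simp add: compose_def)
      then show ?thesis using that a(2) b(2) by auto
    qed
    then have "compose (carrier G) b a ` H \<subseteq> L" by blast
    then have "\<exists>c\<in>A. c ` H \<subseteq> L"
      using aut_closed(3)[OF b(1) a(1)] by (rule bexI)
    then show ?thesis
      using class_poset_le_iff[OF H(1) L(1)] H(2) L(2) by simp
  qed
  show ?thesis
  proof unfold_locales
    fix X Y Z assume "X .=\<^bsub>class_poset G A\<^esub> Y" "Y .=\<^bsub>class_poset G A\<^esub> Z"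
    then show "X .=\<^bsub>class_poset G A\<^esub> Z" by (simp add: eq)
  next
    fix X Y Z assume *: "X \<sqsubseteq>\<^bsub>class_poset G A\<^esub> Y" "Y \<sqsubseteq>\<^bsub>class_poset G A\<^esub> Z"
      "X \<in> carrier (class_poset G A)" "Y \<in> carrier (class_poset G A)"
      "Z \<in> carrier (class_poset G A)"
    show "X \<sqsubseteq>\<^bsub>class_poset G A\<^esub> Z" by (rule trans[OF *])
  next
    fix X Y assume *: "X \<sqsubseteq>\<^bsub>class_poset G A\<^esub> Y" "Y \<sqsubseteq>\<^bsub>class_poset G A\<^esub> X"
      "X \<in> carrier (class_poset G A)" "Y \<in> carrier (class_poset G A)"
    show "X .=\<^bsub>class_poset G A\<^esub> Y" using antisym[OF *] by (simp add: eq)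
  qed (simp_all add: eq refl)
qed

end

end

(* Sort the tuples by the class of the subgroup K that they generate: sigma_A(H,t) counts the tuples
   with [K] \<le> [H], so the right-hand side is the sum over all tuples of the sums of mu_A(X,G) over
   the classes X \<ge> [K]. Moebius inversion evaluates such a sum to 1 if [K] = [G], that is K = G, and
   to 0 otherwise. *)

theory Submission
  imports Defs
begin

text \<open>Indicators over the whole carrier, rather than a sum over an interval, let double sums
  be interchanged freely later. The points \<open>x\<close> and \<open>y\<close> may be
  incomparable: by transitivity the interval is then empty, so the sum is 0.\<close>

lemma sum_moebius_interval:
  assumes "partial_order P" "finite (carrier P)" "is_moebius P f" "x \<in> carrier P" "y \<in> carrier P"
  shows "(\<Sum>z\<in>carrier P. if x \<sqsubseteq>\<^bsub>P\<^esub> z \<and> z \<sqsubseteq>\<^bsub>P\<^esub> y then f x z else 0) = (if x = y then 1 else 0)"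
proof -
  interpret partial_order P by fact
  let ?I = "{z \<in> carrier P. x \<sqsubseteq>\<^bsub>P\<^esub> z \<and> z \<sqsubseteq>\<^bsub>P\<^esub> y}"
  have "(\<Sum>z\<in>?I. f x z) = (if x = y then 1 else 0)"
  proof -
    consider "x = y" | "x \<sqsubset>\<^bsub>P\<^esub> y" | "x \<noteq> y" "\<not> x \<sqsubseteq>\<^bsub>P\<^esub> y" by (auto simp: lless_eq)
    then show ?thesis
    proof cases
      case 1
      then have "?I = {x}" using assms(4) by (auto intro: le_antisym)
      then show ?thesis using 1 assms(3,4) by (simp add: is_moebius_def)
    next
      case 2
      then have "(\<Sum>z\<in>?I. f x z) = 0" using assms(3-5) unfolding is_moebius_def by blast
      then show ?thesis using 2 by (simp add: lless_eq)
    next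
      case 3
      then have "?I = {}" using assms(4,5) by (auto dest: le_trans)
      then show ?thesis unfolding \<open>?I = {}\<close> using 3 by simp
    qed
  qed
  then show ?thesis using assms(2) by (simp add: sum.inter_filter)
qed

text \<open>A left inverse of the zeta function is also a right inverse: compare \<open>\<mu>\<close> with the Moebius
  function \<open>\<nu>\<close> of the dual poset by evaluating the sum of \<open>\<mu>(x,z) \<nu>(w,y)\<close> over \<open>x \<le> z \<le> w \<le> y\<close>
  in both orders.\<close>

lemma moebius_dual:
  assumes "partial_order P" "finite (carrier P)" "x \<in> carrier P" "y \<in> carrier P"
  shows "moebius P x y = moebius (inv_gorder P) y x"
proof -
  interpret partial_order P by fact
  let ?C = "carrier P"
  define m where "m = moebius P"
  define n where "n = moebius (inv_gorder P)"
  have m: "is_moebius P m"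
    unfolding m_def by (rule is_moebius_moebius[OF assms(1,2)])
  have n: "is_moebius (inv_gorder P) n"
    unfolding n_def by (rule is_moebius_moebius[OF dual_order]) (simp add: assms(2))
  have sm: "(\<Sum>z\<in>?C. if u \<sqsubseteq>\<^bsub>P\<^esub> z \<and> z \<sqsubseteq>\<^bsub>P\<^esub> v then m u z else 0) = (if u = v then 1 else 0)"
    if "u \<in> ?C" "v \<in> ?C" for u v
    by (rule sum_moebius_interval[OF assms(1,2) m that])
  have sn: "(\<Sum>z\<in>?C. if u \<sqsubseteq>\<^bsub>P\<^esub> z \<and> z \<sqsubseteq>\<^bsub>P\<^esub> v then n v z else 0) = (if u = v then 1 else 0)"
    if "u \<in> ?C" "v \<in> ?C" for u v
    \<comment> \<open>The interval from \<open>v\<close> to \<open>u\<close> in the dual is the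
      interval from \<open>u\<close> to \<open>v\<close> in \<open>P\<close>, with the two
      conditions in the opposite order.\<close>
    using sum_moebius_interval[OF dual_order _ n, of v u] that assms(2)
    by (simp add: conj_commute eq_commute)
  have m0: "m x z = 0" if "z \<in> ?C" "\<not> x \<sqsubseteq>\<^bsub>P\<^esub> z" for z
    using m that assms(3) unfolding is_moebius_def by blast
  have n0: "n y w = 0" if "w \<in> ?C" "\<not> w \<sqsubseteq>\<^bsub>P\<^esub> y" for w
    using n that assms(4) unfolding is_moebius_def by simp
  \<comment> \<open>By \<open>m0\<close> and \<open>n0\<close> the factors vanish unless
    \<open>x\<close> lies below \<open>z\<close> and \<open>w\<close> lies below \<open>y\<close>,
    so only the relation between \<open>z\<close> and \<open>w\<close> has to be tested. The summand
    thus fits both orders of summation.\<close>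
  let ?s = "\<lambda>z w. if z \<sqsubseteq>\<^bsub>P\<^esub> w then m x z * n y w else 0"
  have "m x y = (\<Sum>z\<in>?C. m x z * (if z = y then 1 else 0))"
    using assms(2,4) by (simp add: if_distrib[of "(*) _"] cong: if_cong)
  also have "\<dots> = (\<Sum>z\<in>?C. m x z * (\<Sum>w\<in>?C. if z \<sqsubseteq>\<^bsub>P\<^esub> w \<and> w \<sqsubseteq>\<^bsub>P\<^esub> y then n y w else 0))"
    using sn assms(4) by (intro sum.cong) simp_all
  also have "\<dots> = (\<Sum>z\<in>?C. \<Sum>w\<in>?C. ?s z w)"
    unfolding sum_distrib_left using n0 by (intro sum.cong) auto
  also have "\<dots> = (\<Sum>w\<in>?C. \<Sum>z\<in>?C. ?s z w)"
    by (rule sum.swap)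
  also have "\<dots> = (\<Sum>w\<in>?C. (\<Sum>z\<in>?C. if x \<sqsubseteq>\<^bsub>P\<^esub> z \<and> z \<sqsubseteq>\<^bsub>P\<^esub> w then m x z else 0) * n y w)"
    unfolding sum_distrib_right using m0 by (intro sum.cong) auto
  also have "\<dots> = (\<Sum>w\<in>?C. (if x = w then 1 else 0) * n y w)"
    using sm assms(3) by (intro sum.cong) simp_all
  also have "\<dots> = n y x"
    using assms(2,3) by (simp add: if_distrib[of "\<lambda>c. c * _"] cong: if_cong)
  finally show ?thesis by (simp add: m_def n_def)
qed

text \<open>The defining recursion varies the second argument of the Moebius function, whereas here
  the first one varies. Passing to the dual poset exchanges the arguments and turns the sum into the
  defining one. An upper bound \<open>y\<close> on \<open>z\<close> is implicit, since
  \<open>moebius P z y\<close> vanishes without it.\<close>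

lemma sum_moebius_above:
  assumes "partial_order P" "finite (carrier P)" "x \<in> carrier P" "y \<in> carrier P"
  shows "(\<Sum>z\<in>carrier P. if x \<sqsubseteq>\<^bsub>P\<^esub> z then moebius P z y else 0) = (if x = y then 1 else 0)"
proof -
  interpret partial_order P by fact
  let ?D = "inv_gorder P"
  have "moebius P z y = 0" if "z \<in> carrier P" "\<not> z \<sqsubseteq>\<^bsub>P\<^esub> y" for z
    using is_moebius_moebius[OF assms(1,2)] that assms(4) unfolding is_moebius_def by blast
  then have "(\<Sum>z\<in>carrier P. if x \<sqsubseteq>\<^bsub>P\<^esub> z then moebius P z y else 0)
      = (\<Sum>z\<in>carrier ?D. if y \<sqsubseteq>\<^bsub>?D\<^esub> z \<and> z \<sqsubseteq>\<^bsub>?D\<^esub> x then moebius ?D y z else 0)"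
    using moebius_dual[OF assms(1,2) _ assms(4)] by (intro sum.cong) auto
  also have "\<dots> = (if x = y then 1 else 0)"
    using sum_moebius_interval[OF dual_order _ is_moebius_moebius[OF dual_order], of y x] assms(2-4)
    by (simp add: eq_commute)
  finally show ?thesis .
qed

context
  fixes G :: "('a, 'b) monoid_scheme" and A :: "('a \<Rightarrow> 'a) set"
  assumes grp: "group G" and fin: "finite (carrier G)" and sub: "subgroup A (AutoGroup G)"
begin

lemma aut_bij:
  assumes "a \<in> A" shows "bij_betw a (carrier G) (carrier G)"
  using aut_closed(1)[OF grp fin sub assms] by (simp add: auto_def Bij_def)

lemma aut_image_subgroup:
  assumes "subgroup H G" "a \<in> A"
  shows "subgroup (a ` H) G"
proof -
  have "a \<in> hom G G"
    using aut_closed(1)[OF grp fin sub assms(2)] by (simp add: auto_def)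
  then have "group_hom G G a"
    using grp by (simp add: group_hom_def group_hom_axioms_def)
  then show ?thesis
    by (rule group_hom.subgroup_img_is_subgroup[OF _ assms(1)])
qed

text \<open>The classes are orbits, so each is the class of any of its members. This is what allows
  an arbitrary choice \<open>rep\<close> of representatives in the theorem.\<close>

lemma class_member:
  assumes "X \<in> carrier (class_poset G A)" "H \<in> X"
  shows "subgroup H G" "aut_class A H = X"
proof -
  obtain K a where K: "subgroup K G" "X = aut_class A K" and a: "a \<in> A" "H = a ` K"
    using assms by (auto simp: class_poset_def aut_class_def)
  show "subgroup H G" using aut_image_subgroup K a by simp
  show "aut_class A H = X"
    using aut_class_trans[OF grp fin sub subgroup.subset[OF K(1)] a(1)] K a by simp
qed

text \<open>The count \<open>sigma_A\<close> moves the larger subgroup, the order on classes the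
  smaller one; inverse automorphisms translate between the two.\<close>

lemma subset_conj_iff:
  assumes "K \<subseteq> carrier G" "H \<subseteq> carrier G"
  shows "(\<exists>a\<in>A. K \<subseteq> a ` H) \<longleftrightarrow> (\<exists>a\<in>A. a ` K \<subseteq> H)"
proof -
  \<comment> \<open>The inverse is restricted to the carrier because the elements of
    \<open>A\<close> are extensional functions; in this form \<open>aut_closed(4)\<close> places it
    in \<open>A\<close>.\<close>
  let ?inv = "\<lambda>a. \<lambda>x\<in>carrier G. inv_into (carrier G) a x"
  have invl: "?inv a (a x) = x" if "a \<in> A" "x \<in> carrier G" for a x
    using aut_bij[OF that(1)] that(2) by (auto simp: bij_betw_def)
  have "?inv a ` K \<subseteq> H" if a: "a \<in> A" and sub: "K \<subseteq> a ` H" for a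
  proof
    fix y assume "y \<in> ?inv a ` K"
    then obtain h where "h \<in> H" "y = ?inv a (a h)" using sub by blast
    then show "y \<in> H" using invl[OF a, of h] assms(2) by auto
  qed
  moreover have "K \<subseteq> ?inv a ` H" if "a \<in> A" "a ` K \<subseteq> H" for a
  proof
    fix k assume "k \<in> K"
    then have "k = ?inv a (a k)" "a k \<in> H" using invl[OF that(1), of k] that(2) assms(1) by auto
    then show "k \<in> ?inv a ` H" by (rule image_eqI)
  qed
  ultimately show ?thesis using aut_closed(4)[OF grp fin sub] by meson
qed

text \<open>Every automorphism maps the whole group onto itself, so the top class has a single
  member.\<close>

lemma aut_class_eq_top_iff:
  assumes "subgroup K G"
  shows "aut_class A K = aut_class A (carrier G) \<longleftrightarrow> K = carrier G"
proof
  assume "aut_class A K = aut_class A (carrier G)"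
  then have "K \<in> aut_class A (carrier G)"
    using self_in_aut_class[OF grp fin sub subgroup.subset[OF assms]] by simp
  then obtain a where "a \<in> A" "K = a ` carrier G" by (auto simp: aut_class_def)
  then show "K = carrier G"
    using aut_bij[of a] by (simp add: bij_betw_def)
qed simp

end

theorem theorem18:
  fixes G :: "('a, 'b) monoid_scheme" and A :: "('a \<Rightarrow> 'a) set" and t :: nat
    and rep :: "'a set set \<Rightarrow> 'a set"
  assumes "group G" and "finite (carrier G)"
    and "subgroup A (AutoGroup G)"
    and "t > 0"
    and rep: "\<And>X. X \<in> carrier (class_poset G A) \<Longrightarrow> rep X \<in> X"
  shows "int (phi_star G t) =
    (\<Sum>X\<in>carrier (class_poset G A). mu_A G A (rep X) (carrier G) * int (sigma_A G A (rep X) t))"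
proof -
  interpret group G by fact
  note ctx = assms(1-3)
  let ?P = "class_poset G A" and ?T = "subgroup_tuples G t" and ?top = "aut_class A (carrier G)"
  define gen where "gen Hs = generate G (\<Union>i\<in>{1..t}. Hs i)" for Hs :: "nat \<Rightarrow> 'a set"
  have "finite {H. subgroup H G}"
    by (rule finite_subset[of _ "Pow (carrier G)"]) (auto simp: assms(2) dest: subgroup.subset)
  then have finT: "finite ?T"
    unfolding subgroup_tuples_def by (intro finite_PiE) auto
  have gen_subgroup: "subgroup (gen Hs) G" if "Hs \<in> ?T" for Hs
    unfolding gen_def
    using that by (intro generate_is_subgroup) (auto simp: subgroup_tuples_def dest!: PiE_mem subgroup.subset)
  have class_mem: "aut_class A H \<in> carrier ?P" if "subgroup H G" for H
    using that by (auto simp: class_poset_def)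
  have sigma: "int (sigma_A G A (rep X) t) = (\<Sum>Hs\<in>?T. if aut_class A (gen Hs) \<sqsubseteq>\<^bsub>?P\<^esub> X then 1 else 0)"
    if X: "X \<in> carrier ?P" for X
  proof -
    note r = class_member[OF ctx X rep[OF X]]
    have "(\<exists>a\<in>A. gen Hs \<subseteq> a ` rep X) \<longleftrightarrow> aut_class A (gen Hs) \<sqsubseteq>\<^bsub>?P\<^esub> X" if "Hs \<in> ?T" for Hs
      using subset_conj_iff[OF ctx subgroup.subset[OF gen_subgroup[OF that]] subgroup.subset[OF r(1)]]
        class_poset_le_iff[OF ctx gen_subgroup[OF that] r(1)] r(2) by simp
    then have "{Hs \<in> ?T. \<exists>a\<in>A. gen Hs \<subseteq> a ` rep X} = {Hs \<in> ?T. aut_class A (gen Hs) \<sqsubseteq>\<^bsub>?P\<^esub> X}"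
      by blast
    then show ?thesis
      unfolding sigma_A_def gen_def[symmetric] using finT by (simp add: sum.If_cases Int_def)
  qed
  have "(\<Sum>X\<in>carrier ?P. mu_A G A (rep X) (carrier G) * int (sigma_A G A (rep X) t))
      = (\<Sum>X\<in>carrier ?P. \<Sum>Hs\<in>?T. if aut_class A (gen Hs) \<sqsubseteq>\<^bsub>?P\<^esub> X then moebius ?P X ?top else 0)"
    \<comment> \<open>Inside \<open>mu_A\<close> the class of \<open>rep X\<close> is
      \<open>X\<close> itself, so the representatives disappear from the sum.\<close>
    using class_member(2)[OF ctx _ rep]
    by (intro sum.cong) (auto simp: mu_A_def sigma sum_distrib_left intro!: sum.cong)
  also have "\<dots> = (\<Sum>Hs\<in>?T. \<Sum>X\<in>carrier ?P. if aut_class A (gen Hs) \<sqsubseteq>\<^bsub>?P\<^esub> X then moebius ?P X ?top else 0)"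
    by (rule sum.swap)
  also have "\<dots> = (\<Sum>Hs\<in>?T. if carrier G = gen Hs then 1 else 0)"
  proof (rule sum.cong[OF refl])
    fix Hs assume Hs: "Hs \<in> ?T"
    show "(\<Sum>X\<in>carrier ?P. if aut_class A (gen Hs) \<sqsubseteq>\<^bsub>?P\<^esub> X then moebius ?P X ?top else 0)
        = (if carrier G = gen Hs then 1 else 0)"
      using sum_moebius_above[OF partial_order_class_poset[OF ctx] finite_class_poset[OF ctx]
          class_mem[OF gen_subgroup[OF Hs]] class_mem[OF subgroup_self]]
        aut_class_eq_top_iff[OF ctx gen_subgroup[OF Hs]] by auto
  qed
  also have "\<dots> = int (phi_star G t)"
    unfolding phi_star_def gen_def[symmetric] using finT by (simp add: sum.If_cases Int_def)
  finally show ?thesis by simp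
qed

end
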